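(* Let $\mathcal{V}_1$ and $\mathcal{V}_2$ be nonsingular matrix subspaces of $\mathbb{C}^{n\times n}$ over $\mathbb{C}$ of dimension $2$. Let $X,Y\in\mathbb{C}^{n\times n}$ be invertible matrices and $X_1,X_2\in\mathbb{C}^{n\times n}$ be matrices such that $$X\mathcal{V}_1=\mathrm{span}\{I,X_1\}\quad\text{and}\quad \mathcal{V}_2Y^{-1}=\mathrm{span}\{I,X_2\}.$$ If the closure of $\mathcal{V}_1\mathcal{V}_2$ is a matrix subspace of $\mathbb{C}^{n\times n}$ over $\mathbb{C}$, then this closure has dimension at most $3$. Moreover, the closure of $\mathcal{V}_1\mathcal{V}_2$ is a matrix subspace if and only if $$X_1(cX_2-dI)=aX_2-bI$$ for some constants $a,b,c,d\in\mathbb{C}$ not all zero.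
   Context: A matrix subspace of $\mathbb{C}^{n\times n}$ over $\mathbb{C}$ is a $\mathbb{C}$-linear subspace of $\mathbb{C}^{n\times n}$. It is called nonsingular if it contains an invertible matrix. For matrix subspaces $\mathcal{V}_1,\mathcal{V}_2$ the set of products is $\mathcal{V}_1\mathcal{V}_2=\{V_1V_2 : V_1\in\mathcal{V}_1,\ V_2\in\mathcal{V}_2\}$ (products only, not sums of products). $X\mathcal{V}_1=\{XV : V\in\mathcal{V}_1\}$ and $\mathcal{V}_2Y^{-1}=\{VY^{-1} : V\in\mathcal{V}_2\}$. Closures are taken in the standard topology of $\mathbb{C}^{n\times n}$, and spans are over $\mathbb{C}$. Invertible $X,Y$ as in the claim exist because the subspaces are nonsingular (e.g. $X^{-1}\in\mathcal{V}_1$, $Y\in\mathcal{V}_2$ invertible). *)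

theory Defs
  imports "HOL-Analysis.Analysis"
begin

text \<open>
  The library's \<open>*s\<close> scales by an element of the entry type and \<open>*\<^sub>R\<close> only by reals; on
  \<open>complex ^ 'n ^ 'n\<close> neither is scalar multiplication by a complex number. The library
  constants \<open>subspace\<close>, \<open>span\<close>, \<open>dim\<close> on this type are the real ones. The complex
  versions come from the interpretation \<open>cmat\<close> below.
\<close>

definition cmat_scale :: "complex \<Rightarrow> complex ^ 'n ^ 'n \<Rightarrow> complex ^ 'n ^ 'n" (infixr "*\<^sub>C" 75)
  where "c *\<^sub>C A = (\<chi> i j. c * A $ i $ j)"

definition cmat_basis :: "(complex ^ 'n ^ 'n) set"
  where "cmat_basis = range (\<lambda>(i, j). axis i (axis j 1))"

lemma cmat_scale_nth [simp]: "(c *\<^sub>C A) $ i $ j = c * A $ i $ j"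
  by (simp add: cmat_scale_def)

interpretation cmat: vector_space cmat_scale
  by unfold_locales (simp_all add: vec_eq_iff algebra_simps)

lemma cmat_unit_nth: "axis i (axis j (1::complex)) $ k $ l = (if k = i \<and> l = j then 1 else 0)"
  by (simp add: axis_def)

lemma inj_cmat_unit: "inj (\<lambda>(i, j). axis i (axis j 1) :: complex ^ 'n ^ 'n)"
  by (auto simp: inj_def axis_eq_axis)

lemma cmat_expansion:
  fixes f :: "'n::finite \<times> 'n \<Rightarrow> complex"
  shows "(\<Sum>p\<in>UNIV. f p *\<^sub>C (case p of (i, j) \<Rightarrow> axis i (axis j 1))) $ k $ l = f (k, l)"
proof -
  have "(\<Sum>p\<in>UNIV. f p *\<^sub>C (case p of (i, j) \<Rightarrow> axis i (axis j 1))) $ k $ l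
      = (\<Sum>p\<in>UNIV. if p = (k, l) then f p else 0)"
    unfolding sum_component by (intro sum.cong) (auto simp: cmat_unit_nth split: prod.splits)
  then show ?thesis by simp
qed

lemma independent_cmat_basis: "cmat.independent (cmat_basis :: (complex ^ 'n ^ 'n) set)"
proof (rule cmat.independent_if_scalars_zero)
  let ?e = "\<lambda>(i, j). axis i (axis j 1) :: complex ^ 'n ^ 'n"
  fix f :: "complex ^ 'n ^ 'n \<Rightarrow> complex" and x :: "complex ^ 'n ^ 'n"
  assume s: "(\<Sum>x\<in>cmat_basis. f x *\<^sub>C x) = 0" and "x \<in> cmat_basis"
  then obtain k l where x: "x = ?e (k, l)" by (auto simp: cmat_basis_def)
  have "(\<Sum>p\<in>UNIV. f (?e p) *\<^sub>C ?e p) = 0"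
    using s by (simp add: cmat_basis_def sum.reindex[OF inj_cmat_unit] o_def)
  then have "(\<Sum>p\<in>UNIV. f (?e p) *\<^sub>C ?e p) $ k $ l = 0" by (simp only: zero_index)
  then show "f x = 0" unfolding cmat_expansion x .
qed (simp add: cmat_basis_def)

lemma span_cmat_basis: "cmat.span (cmat_basis :: (complex ^ 'n ^ 'n) set) = UNIV"
proof -
  let ?e = "\<lambda>(i, j). axis i (axis j 1) :: complex ^ 'n ^ 'n"
  have "A \<in> cmat.span cmat_basis" for A :: "complex ^ 'n ^ 'n"
  proof -
    have "A = (\<Sum>p\<in>UNIV. (A $ fst p $ snd p) *\<^sub>C ?e p)"
      by (simp add: vec_eq_iff cmat_expansion del: sum_component)
    also have "\<dots> \<in> cmat.span cmat_basis"
      by (intro cmat.span_sum cmat.span_scale cmat.span_base) (auto simp: cmat_basis_def)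
    finally show ?thesis .
  qed
  then show ?thesis by auto
qed

interpretation cmat: finite_dimensional_vector_space cmat_scale cmat_basis
  by unfold_locales
    (simp_all add: independent_cmat_basis span_cmat_basis, simp add: cmat_basis_def)

definition nonsingular :: "(complex ^ 'n ^ 'n) set \<Rightarrow> bool"
  where "nonsingular V \<longleftrightarrow> (\<exists>A\<in>V. invertible A)"

definition set_prod :: "(complex ^ 'n ^ 'n) set \<Rightarrow> (complex ^ 'n ^ 'n) set \<Rightarrow> (complex ^ 'n ^ 'n) set"
  where "set_prod V W = {A ** B | A B. A \<in> V \<and> B \<in> W}"

end

theory Submission
  imports Defs
begin

text \<open>
  A product \<open>(a A + b B)(c C + d D)\<close> of elements of two pencils is the linear combination of
  \<open>AC, AD, BC, BD\<close> with coefficients \<open>ac, ad, bc, bd\<close>, and the coefficient quadruples that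
  arise in this way are exactly the singular \<open>2 \<times> 2\<close> matrices (\<open>set_prod_span_pairs\<close>). So the
  set of products is the image \<open>f(Z)\<close> of the determinantal cone \<open>Z\<close> of singular \<open>2 \<times> 2\<close>
  matrices under a linear map \<open>f\<close>, and everything depends on whether \<open>f\<close> has a kernel.

  If \<open>f\<close> is injective, then \<open>f(Z)\<close> is closed, since \<open>Z\<close> is, and it is no more a subspace than
  \<open>Z\<close> itself, because the identity is a sum of two singular matrices
  (\<open>closure_cone_not_subspace\<close>).

  If \<open>f\<close> kills some \<open>K \<noteq> 0\<close>, then \<open>f(T) = f(T + s K)\<close>, and \<open>det (T + s K)\<close> is a polynomial in
  \<open>s\<close> of degree at most 2, which has a root unless it is constant. It is nonconstant for all
  \<open>T\<close> in a dense set (\<open>dense_singular_translates\<close>), so \<open>f(Z)\<close> is dense in the range of \<open>f\<close>.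
  Hence its closure is that range (\<open>closure_cone_eq_range\<close>), a subspace spanned by four linearly
  dependent matrices, of dimension at most 3.

  When \<open>X V1 = span {I, X1}\<close> and \<open>V2 = span {I, X2} Y\<close>, removing the invertible outer factors
  turns a kernel element into a relation between \<open>I, X1, X2, X1 X2\<close>, which is the stated
  equation with its terms collected on one side.
\<close>

section \<open>Singular two-by-two matrices along a line\<close>

text \<open>The symmetric bilinear form obtained by polarising the quadratic form \<open>det\<close>.\<close>

definition det_polar :: "complex ^ 2 ^ 2 \<Rightarrow> complex ^ 2 ^ 2 \<Rightarrow> complex"
  where "det_polar S T = S$1$1 * T$2$2 + S$2$2 * T$1$1 - S$1$2 * T$2$1 - S$2$1 * T$1$2"

lemma det_add_scale:
  "det (T + s *\<^sub>C K) = det T + s * det_polar T K + s\<^sup>2 * det K"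
  by (simp add: det_2 det_polar_def algebra_simps power2_eq_square)

lemma det_polar_add_scaleR:
  "det_polar (S + r *\<^sub>R T) K = det_polar S K + of_real r * det_polar T K"
proof -
  have "(S + r *\<^sub>R T) $ i $ j = S $ i $ j + of_real r * T $ i $ j" for i j
    by (simp only: vector_add_component vector_scaleR_component
        scaleR_conv_of_real[where 'a = complex])
  then show ?thesis
    unfolding det_polar_def by (simp only:) (simp add: algebra_simps)
qed

text \<open>
  Each entry of \<open>K\<close> is, up to sign, the pairing of \<open>K\<close> with a matrix unit, namely the one in the
  diagonally opposite position.
\<close>

lemma det_polar_nondegenerate:
  assumes "K \<noteq> 0"
  obtains E where "det_polar E K \<noteq> 0"
proof -
  obtain i j where "K $ i $ j \<noteq> 0"
    using assms by (auto simp: vec_eq_iff)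
  then have "K$1$1 \<noteq> 0 \<or> K$1$2 \<noteq> 0 \<or> K$2$1 \<noteq> 0 \<or> K$2$2 \<noteq> 0"
    using exhaust_2[of i] exhaust_2[of j] by auto
  then show ?thesis
    using that[of "axis 2 (axis 2 1)"] that[of "axis 2 (axis 1 1)"]
      that[of "axis 1 (axis 2 1)"] that[of "axis 1 (axis 1 1)"]
    by (auto simp: det_polar_def cmat_unit_nth simp del: axis_nth)
qed

lemma complex_quadratic_root:
  fixes p q r :: complex
  assumes "r \<noteq> 0 \<or> q \<noteq> 0"
  obtains s where "p + s * q + s\<^sup>2 * r = 0"
proof (cases "r = 0")
  case True
  with assms have "p + (- p / q) * q + (- p / q)\<^sup>2 * r = 0" by simp
  with that show ?thesis by blast
next
  case False
  \<comment> \<open>The quadratic formula, with \<open>w\<close> a square root of the discriminant.\<close>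
  define w where "w = csqrt (q\<^sup>2 - 4 * p * r)"
  have w: "w\<^sup>2 = q\<^sup>2 - 4 * p * r" by (simp add: w_def)
  define s where "s = (w - q) / (2 * r)"
  have "w = 2 * r * s + q" using False by (simp add: s_def)
  with w have "4 * r * (p + s * q + s\<^sup>2 * r) = 0"
    by (simp add: power2_eq_square algebra_simps)
  with False that show ?thesis by simp
qed

text \<open>
  Along the line \<open>T + s K\<close> the determinant is a quadratic polynomial in \<open>s\<close>, and a line without
  singular points needs \<open>det K = 0\<close> and \<open>det_polar T K = 0\<close>. The second equation defines a proper
  hyperplane of matrices \<open>T\<close>, which any transversal perturbation of \<open>T\<close> leaves.
\<close>

lemma dense_singular_translates:
  fixes K T :: "complex ^ 2 ^ 2"
  assumes "K \<noteq> 0"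
  shows "T \<in> closure {T. \<exists>s. det (T + s *\<^sub>C K) = 0}" (is "T \<in> closure ?S")
proof -
  have root: "T' \<in> ?S" if "det K \<noteq> 0 \<or> det_polar T' K \<noteq> 0" for T'
  proof -
    from that obtain s where "det T' + s * det_polar T' K + s\<^sup>2 * det K = 0"
      by (rule complex_quadratic_root)
    then show ?thesis by (auto simp: det_add_scale)
  qed
  show ?thesis
  proof (cases "det_polar T K = 0")
    case False
    then have "T \<in> ?S" by (intro root) simp
    then show ?thesis by (rule subsetD[OF closure_subset])
  next
    case True
    obtain E where E: "det_polar E K \<noteq> 0" using det_polar_nondegenerate[OF assms] .
    have "T + inverse (real (Suc n)) *\<^sub>R E \<in> ?S" for n
      by (intro root disjI2) (use True E in \<open>simp add: det_polar_add_scaleR del: of_nat_Suc\<close>)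
    moreover have "(\<lambda>n. T + inverse (real (Suc n)) *\<^sub>R E) \<longlonglongrightarrow> T + 0 *\<^sub>R E"
      by (rule tendsto_add[OF tendsto_const
            tendsto_scaleR[OF LIMSEQ_inverse_real_of_nat tendsto_const]])
    ultimately show ?thesis
      unfolding closure_sequential
      by (intro exI[of _ "\<lambda>n. T + inverse (real (Suc n)) *\<^sub>R E"]) simp
  qed
qed

section \<open>The closure of a linear image of the determinantal cone\<close>

definition lincomb4 ::
    "complex ^ 'n ^ 'n \<Rightarrow> complex ^ 'n ^ 'n \<Rightarrow> complex ^ 'n ^ 'n \<Rightarrow> complex ^ 'n ^ 'n
      \<Rightarrow> complex ^ 2 ^ 2 \<Rightarrow> complex ^ 'n ^ 'n"
  where "lincomb4 A B C D T
    = T$1$1 *\<^sub>C A + T$1$2 *\<^sub>C B + T$2$1 *\<^sub>C C + T$2$2 *\<^sub>C D"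

lemma linear_lincomb4: "linear (lincomb4 A B C D)"
  by (rule linearI) (simp_all add: lincomb4_def vec_eq_iff algebra_simps)

lemma lincomb4_add_kernel:
  assumes "lincomb4 A B C D K = 0"
  shows "lincomb4 A B C D (T + s *\<^sub>C K) = lincomb4 A B C D T"
proof -
  have "lincomb4 A B C D (T + s *\<^sub>C K)
      = lincomb4 A B C D T + s *\<^sub>C lincomb4 A B C D K"
    by (simp add: lincomb4_def vec_eq_iff algebra_simps)
  with assms show ?thesis by simp
qed

lemma surj_matrix_2:
  obtains T :: "complex ^ 2 ^ 2"
  where "T$1$1 = a" "T$1$2 = b" "T$2$1 = c" "T$2$2 = d"
proof
  let ?T = "vector [vector [a, b], vector [c, d]] :: complex ^ 2 ^ 2"
  show "?T$1$1 = a" "?T$1$2 = b" "?T$2$1 = c" "?T$2$2 = d" by simp_all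
qed

lemma range_lincomb4: "range (lincomb4 A B C D) = cmat.span {A, B, C, D}"
proof
  show "range (lincomb4 A B C D) \<subseteq> cmat.span {A, B, C, D}"
    unfolding lincomb4_def image_subset_iff
    by (intro ballI cmat.span_add cmat.span_scale cmat.span_base) simp_all
  show "cmat.span {A, B, C, D} \<subseteq> range (lincomb4 A B C D)"
  proof
    fix M assume "M \<in> cmat.span {A, B, C, D}"
    then obtain a b c d where "M - a *\<^sub>C A - b *\<^sub>C B - c *\<^sub>C C - d *\<^sub>C D = 0"
      by (auto simp: cmat.span_breakdown_eq)
    then have M: "M = a *\<^sub>C A + b *\<^sub>C B + c *\<^sub>C C + d *\<^sub>C D"
      by (simp add: algebra_simps)
    obtain T :: "complex ^ 2 ^ 2"
      where "T$1$1 = a" "T$1$2 = b" "T$2$1 = c" "T$2$2 = d"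
      by (rule surj_matrix_2)
    then have "M = lincomb4 A B C D T" by (simp add: M lincomb4_def)
    then show "M \<in> range (lincomb4 A B C D)" by blast
  qed
qed

lemma in_span_if_scale_in_span:
  assumes "a *\<^sub>C A = M" and "a \<noteq> 0" and "M \<in> cmat.span S"
  shows "A \<in> cmat.span S"
proof -
  have "inverse a *\<^sub>C M \<in> cmat.span S" using assms(3) by (rule cmat.span_scale)
  then show ?thesis using assms(2) by (simp flip: assms(1))
qed

lemma dim_le_3_if_relation:
  assumes "a *\<^sub>C A + b *\<^sub>C B + c *\<^sub>C C + d *\<^sub>C D = 0" and "a \<noteq> 0"
  shows "cmat.dim {A, B, C, D} \<le> 3"
proof -
  have "a *\<^sub>C A = (- b) *\<^sub>C B + (- c) *\<^sub>C C + (- d) *\<^sub>C D"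
    using assms(1) by (simp add: algebra_simps eq_neg_iff_add_eq_0)
  moreover have "(- b) *\<^sub>C B + (- c) *\<^sub>C C + (- d) *\<^sub>C D \<in> cmat.span {B, C, D}"
    by (intro cmat.span_add cmat.span_scale cmat.span_base) auto
  ultimately have "A \<in> cmat.span {B, C, D}"
    by (rule in_span_if_scale_in_span[OF _ assms(2)])
  then have "cmat.dim {A, B, C, D} \<le> card {B, C, D}"
    by (intro cmat.dim_le_card) (auto intro: cmat.span_base)
  also have "\<dots> \<le> 3" by (simp add: card_insert_if)
  finally show ?thesis .
qed

lemma dim_lincomb4_le_3:
  assumes "lincomb4 A B C D K = 0" and "K \<noteq> 0"
  shows "cmat.dim (range (lincomb4 A B C D)) \<le> 3"
proof -
  obtain a b c d where abcd: "a = K$1$1" "b = K$1$2" "c = K$2$1" "d = K$2$2" by blast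
  have rel: "a *\<^sub>C A + b *\<^sub>C B + c *\<^sub>C C + d *\<^sub>C D = 0"
    using assms(1) by (simp add: lincomb4_def abcd)
  have nz: "a \<noteq> 0 \<or> b \<noteq> 0 \<or> c \<noteq> 0 \<or> d \<noteq> 0"
    using assms(2) by (auto simp: vec_eq_iff forall_2 abcd)
  have "cmat.dim {A, B, C, D} \<le> 3"
    using nz
  proof (elim disjE)
    assume "a \<noteq> 0"
    with rel show ?thesis by (rule dim_le_3_if_relation)
  next
    assume "b \<noteq> 0"
    with rel have "cmat.dim {B, A, C, D} \<le> 3"
      by (intro dim_le_3_if_relation[of b B a A c C d D]) (simp_all add: ac_simps)
    then show ?thesis by (simp add: insert_commute)
  next
    assume "c \<noteq> 0"
    with rel have "cmat.dim {C, A, B, D} \<le> 3"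
      by (intro dim_le_3_if_relation[of c C a A b B d D]) (simp_all add: ac_simps)
    then show ?thesis by (simp add: insert_commute)
  next
    assume "d \<noteq> 0"
    with rel have "cmat.dim {D, A, B, C} \<le> 3"
      by (intro dim_le_3_if_relation[of d D a A b B c C]) (simp_all add: ac_simps)
    then show ?thesis by (simp add: insert_commute)
  qed
  then show ?thesis by (simp add: range_lincomb4)
qed

text \<open>
  Moving along a kernel direction does not change the value, so the image of the cone is also the
  image of the dense set of matrices whose line in that direction meets the cone.
\<close>

lemma closure_cone_eq_range:
  assumes "lincomb4 A B C D K = 0" and "K \<noteq> 0"
  shows "closure (lincomb4 A B C D ` {T. det T = 0}) = range (lincomb4 A B C D)"
    (is "closure (?f ` ?Z) = _")
proof
  have "closed (range ?f)"
    using linear_lincomb4 by (intro closed_subspace linear_subspace_image) auto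
  then show "closure (?f ` ?Z) \<subseteq> range ?f"
    by (intro closure_minimal) auto
  let ?S = "{T. \<exists>s. det (T + s *\<^sub>C K) = 0}"
  have "?f ` ?S \<subseteq> ?f ` ?Z"
  proof clarify
    fix T s assume "det (T + s *\<^sub>C K) = 0"
    then show "?f T \<in> ?f ` ?Z"
      by (intro image_eqI[of _ _ "T + s *\<^sub>C K"]) (simp_all add: lincomb4_add_kernel[OF assms(1)])
  qed
  moreover have "?f ` closure ?S \<subseteq> closure (?f ` ?S)"
    by (intro closure_bounded_linear_image_subset linear_conv_bounded_linear[THEN iffD1] linear_lincomb4)
  moreover have "closure ?S = UNIV"
    using dense_singular_translates[OF assms(2)] by blast
  ultimately show "range ?f \<subseteq> closure (?f ` ?Z)"
    using closure_mono[of "?f ` ?S" "?f ` ?Z"] by simp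
qed

text \<open>
  An injective linear map on a finite-dimensional space maps closed sets to closed sets, so taking
  the closure adds nothing here. The image is not closed under addition because the cone contains
  both diagonal matrix units but not their sum, the identity.
\<close>

lemma closure_cone_not_subspace:
  assumes "\<And>K. lincomb4 A B C D K = 0 \<Longrightarrow> K = 0"
  shows "\<not> cmat.subspace (closure (lincomb4 A B C D ` {T. det T = 0}))"
    (is "\<not> cmat.subspace (closure (?f ` ?Z))")
proof
  assume sub: "cmat.subspace (closure (?f ` ?Z))"
  have inj: "inj ?f"
    using assms by (simp add: linear_injective_0[OF linear_lincomb4])
  have "closed ?Z"
    unfolding det_2 by (intro closed_Collect_eq continuous_intros)
  then have "closed (?f ` ?Z)"
    by (rule closed_injective_linear_image[OF _ linear_lincomb4 inj])
  with sub have sub': "cmat.subspace (?f ` ?Z)" by (simp add: closure_closed)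
  let ?E = "\<lambda>i. axis i (axis i 1) :: complex ^ 2 ^ 2"
  have "?f (?E 1) \<in> ?f ` ?Z" "?f (?E 2) \<in> ?f ` ?Z"
    by (auto simp: det_2 cmat_unit_nth)
  then have "?f (?E 1) + ?f (?E 2) \<in> ?f ` ?Z" by (rule cmat.subspace_add[OF sub'])
  then have "?E 1 + ?E 2 \<in> ?Z"
    by (simp add: linear_add[OF linear_lincomb4, symmetric] inj_image_mem_iff[OF inj] del: mem_Collect_eq)
  then show False by (simp add: det_2 cmat_unit_nth vector_add_component del: axis_nth)
qed

section \<open>Products of two pencils\<close>

lemma span_pair: "cmat.span {A, B} = {a *\<^sub>C A + b *\<^sub>C B | a b. True}"
proof -
  have "M \<in> cmat.span {A, B} \<longleftrightarrow> (\<exists>a b. M = a *\<^sub>C A + b *\<^sub>C B)" for M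
    by (auto simp: cmat.span_breakdown_eq algebra_simps)
  then show ?thesis by auto
qed

lemma matrix_mult_add_rdistrib: "(A + B) ** C = A ** C + B ** C"
  for C :: "'a::semiring_1 ^ 'n ^ 'm"
  by (simp add: vec_eq_iff matrix_matrix_mult_def sum.distrib distrib_right)

lemma matrix_inv_mult:
  assumes "invertible A"
  shows "A ** matrix_inv A = mat 1" and "matrix_inv A ** A = mat 1"
  using someI_ex[OF assms[unfolded invertible_def]] by (auto simp: matrix_inv_def)

lemma cmat_scale_mult_left: "(a *\<^sub>C A) ** B = a *\<^sub>C (A ** B)"
  for A :: "complex ^ 'n ^ 'n"
  by (simp add: vec_eq_iff matrix_matrix_mult_def sum_distrib_left mult.assoc)

lemma cmat_scale_mult_right: "A ** (a *\<^sub>C B) = a *\<^sub>C (A ** B)"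
  for A :: "complex ^ 'n ^ 'n"
  by (simp add: vec_eq_iff matrix_matrix_mult_def sum_distrib_left mult.left_commute)

text \<open>
  A singular matrix has rank at most one: the second row is a multiple of the first, unless the
  first row vanishes.
\<close>

lemma singular_2_eq_outer:
  fixes T :: "complex ^ 2 ^ 2"
  assumes "det T = 0"
  obtains a b c d where "T$1$1 = a * c" "T$1$2 = a * d" "T$2$1 = b * c" "T$2$2 = b * d"
proof -
  have eq: "T$1$1 * T$2$2 = T$1$2 * T$2$1" using assms by (simp add: det_2)
  show ?thesis
  proof (cases "T$1$1 = 0 \<and> T$1$2 = 0")
    case True
    then show ?thesis by (intro that[where a = 0 and b = 1 and c = "T$2$1" and d = "T$2$2"]) auto
  next
    case False
    then show ?thesis
    proof (cases "T$1$1 = 0")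
      case True
      with False eq show ?thesis
        by (intro that[where a = 1 and b = "T$2$2 / T$1$2" and c = "T$1$1" and d = "T$1$2"]) (auto simp: field_simps)
    next
      case False
      with eq show ?thesis
        by (intro that[where a = 1 and b = "T$2$1 / T$1$1" and c = "T$1$1" and d = "T$1$2"]) (auto simp: field_simps)
    qed
  qed
qed

lemma set_prod_span_pairs:
  "set_prod (cmat.span {A, B}) (cmat.span {C, D})
    = lincomb4 (A ** C) (A ** D) (B ** C) (B ** D) ` {T. det T = 0}" (is "?P = ?f ` ?Z")
proof
  have expand: "(a *\<^sub>C A + b *\<^sub>C B) ** (c *\<^sub>C C + d *\<^sub>C D)
      = (a * c) *\<^sub>C (A ** C) + (a * d) *\<^sub>C (A ** D)
        + (b * c) *\<^sub>C (B ** C) + (b * d) *\<^sub>C (B ** D)" for a b c d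
    by (simp add: matrix_add_ldistrib matrix_mult_add_rdistrib cmat_scale_mult_left
        cmat_scale_mult_right cmat.scale_right_distrib ac_simps)
  show "?P \<subseteq> ?f ` ?Z"
  proof
    fix M assume "M \<in> ?P"
    then obtain a b c d where M: "M = (a *\<^sub>C A + b *\<^sub>C B) ** (c *\<^sub>C C + d *\<^sub>C D)"
      by (auto simp: set_prod_def span_pair)
    obtain T :: "complex ^ 2 ^ 2"
      where T: "T$1$1 = a * c" "T$1$2 = a * d" "T$2$1 = b * c" "T$2$2 = b * d"
      by (rule surj_matrix_2)
    then have "M = ?f T" "det T = 0" by (simp_all add: M expand lincomb4_def det_2)
    then show "M \<in> ?f ` ?Z" by blast
  qed
  show "?f ` ?Z \<subseteq> ?P"
  proof clarify
    fix T :: "complex ^ 2 ^ 2" assume "det T = 0"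
    then obtain a b c d
      where "T$1$1 = a * c" "T$1$2 = a * d" "T$2$1 = b * c" "T$2$2 = b * d"
      by (rule singular_2_eq_outer)
    then have "?f T = (a *\<^sub>C A + b *\<^sub>C B) ** (c *\<^sub>C C + d *\<^sub>C D)"
      by (simp add: lincomb4_def expand)
    then show "?f T \<in> ?P" unfolding set_prod_def span_pair by blast
  qed
qed

lemma eq_span_if_left_mult:
  assumes "P ** X = mat 1" and "(\<lambda>V. X ** V) ` S = cmat.span {A, B}"
  shows "S = cmat.span {P ** A, P ** B}"
proof -
  have "S = (\<lambda>V. P ** V) ` (\<lambda>V. X ** V) ` S"
    by (simp add: image_image matrix_mul_assoc assms(1))
  also have "\<dots> = cmat.span {P ** A, P ** B}"
    unfolding assms(2) span_pair
    by (force simp: matrix_add_ldistrib cmat_scale_mult_right)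
  finally show ?thesis .
qed

lemma eq_span_if_right_mult:
  assumes "Z ** Y = mat 1" and "(\<lambda>V. V ** Z) ` S = cmat.span {A, B}"
  shows "S = cmat.span {A ** Y, B ** Y}"
proof -
  have "S = (\<lambda>V. V ** Y) ` (\<lambda>V. V ** Z) ` S"
    by (simp add: image_image assms(1) flip: matrix_mul_assoc)
  also have "\<dots> = cmat.span {A ** Y, B ** Y}"
    unfolding assms(2) span_pair
    by (force simp: matrix_mult_add_rdistrib cmat_scale_mult_left)
  finally show ?thesis .
qed

theorem theorem2p6:
  fixes V1 V2 :: "(complex ^ 'n ^ 'n) set" and X Y X1 X2 :: "complex ^ 'n ^ 'n"
  assumes "cmat.subspace V1" and "cmat.subspace V2"
    and "nonsingular V1" and "nonsingular V2"
    and "cmat.dim V1 = 2" and "cmat.dim V2 = 2"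
    and "invertible X" and "invertible Y"
    and "(\<lambda>V. X ** V) ` V1 = cmat.span {mat 1, X1}"
    and "(\<lambda>V. V ** matrix_inv Y) ` V2 = cmat.span {mat 1, X2}"
  shows "(cmat.subspace (closure (set_prod V1 V2)) \<longrightarrow> cmat.dim (closure (set_prod V1 V2)) \<le> 3) \<and>
    (cmat.subspace (closure (set_prod V1 V2)) \<longleftrightarrow>
      (\<exists>a b c d :: complex. \<not> (a = 0 \<and> b = 0 \<and> c = 0 \<and> d = 0) \<and>
        X1 ** (c *\<^sub>C X2 - d *\<^sub>C mat 1) = a *\<^sub>C X2 - b *\<^sub>C mat 1))"
proof -
  define P where "P = matrix_inv X"
  have PX: "P ** X = mat 1" and XP: "X ** P = mat 1"
    using assms(7) by (simp_all add: P_def matrix_inv_mult)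
  have ZY: "matrix_inv Y ** Y = mat 1" and YZ: "Y ** matrix_inv Y = mat 1"
    using assms(8) by (simp_all add: matrix_inv_mult)
  \<comment> \<open>\<open>?f\<close> parametrises the products, and \<open>?g\<close> is \<open>?f\<close> stripped of the outer factors \<open>P\<close> and
    \<open>Y\<close>; they have the same kernel.\<close>
  let ?f = "lincomb4 (P ** Y) (P ** (X2 ** Y)) ((P ** X1) ** Y) ((P ** X1) ** (X2 ** Y))"
  let ?g = "lincomb4 (mat 1) X2 X1 (X1 ** X2)"
  let ?rel = "\<exists>a b c d :: complex. \<not> (a = 0 \<and> b = 0 \<and> c = 0 \<and> d = 0) \<and>
        X1 ** (c *\<^sub>C X2 - d *\<^sub>C mat 1) = a *\<^sub>C X2 - b *\<^sub>C mat 1"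
  have prod: "set_prod V1 V2 = ?f ` {T. det T = 0}"
    using eq_span_if_left_mult[OF PX assms(9)] eq_span_if_right_mult[OF ZY assms(10)]
    by (simp add: set_prod_span_pairs)
  have f: "?f T = P ** ?g T ** Y" for T
    by (simp add: lincomb4_def matrix_add_ldistrib matrix_mult_add_rdistrib cmat_scale_mult_left
        cmat_scale_mult_right matrix_mul_assoc)
  have g: "X ** ?f T ** matrix_inv Y = ?g T" for T
  proof -
    have "X ** ?f T ** matrix_inv Y = (X ** P) ** ?g T ** (Y ** matrix_inv Y)"
      unfolding f by (simp only: matrix_mul_assoc)
    then show ?thesis by (simp add: XP YZ)
  qed
  have kernel: "?f T = 0 \<longleftrightarrow> ?g T = 0" for T
    using f[of T] g[of T] by auto
  \<comment> \<open>The coefficients \<open>a\<close> and \<open>d\<close> of the relation occur in the kernel element with a minus sign.\<close>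
  have g_eq_0_iff: "?g T = 0 \<longleftrightarrow> X1 ** (T$2$2 *\<^sub>C X2 - (- T$2$1) *\<^sub>C mat 1)
      = (- T$1$2) *\<^sub>C X2 - T$1$1 *\<^sub>C mat 1" for T
  proof -
    have "X1 ** (T$2$2 *\<^sub>C X2 - (- T$2$1) *\<^sub>C mat 1)
        - ((- T$1$2) *\<^sub>C X2 - T$1$1 *\<^sub>C mat 1) = ?g T"
      by (simp add: lincomb4_def matrix_add_ldistrib cmat_scale_mult_right)
    then show ?thesis by (metis eq_iff_diff_eq_0)
  qed
  have rel: "?rel \<longleftrightarrow> (\<exists>K. K \<noteq> 0 \<and> ?f K = 0)"
  proof
    assume ?rel
    then obtain a b c d where nz: "\<not> (a = 0 \<and> b = 0 \<and> c = 0 \<and> d = 0)"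
      and eq: "X1 ** (c *\<^sub>C X2 - d *\<^sub>C mat 1) = a *\<^sub>C X2 - b *\<^sub>C mat 1" by blast
    obtain K :: "complex ^ 2 ^ 2"
      where K: "K$1$1 = b" "K$1$2 = - a" "K$2$1 = - d" "K$2$2 = c"
      by (rule surj_matrix_2)
    have "?g K = 0" unfolding g_eq_0_iff K using eq by simp
    moreover have "K \<noteq> 0" using K nz by auto
    ultimately show "\<exists>K. K \<noteq> 0 \<and> ?f K = 0" using kernel by blast
  next
    assume "\<exists>K. K \<noteq> 0 \<and> ?f K = 0"
    then obtain K where K: "K \<noteq> 0" "?g K = 0" using kernel by blast
    then have "\<not> (- K$1$2 = 0 \<and> K$1$1 = 0 \<and> K$2$2 = 0 \<and> - K$2$1 = 0)"
      by (auto simp: vec_eq_iff forall_2)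
    with K(2) show ?rel unfolding g_eq_0_iff by blast
  qed
  show ?thesis
  proof (cases ?rel)
    case True
    then obtain K where K: "?f K = 0" "K \<noteq> 0" using rel by blast
    have "closure (set_prod V1 V2) = range ?f"
      unfolding prod by (rule closure_cone_eq_range[OF K])
    moreover have "cmat.subspace (range ?f)"
      by (simp add: range_lincomb4)
    ultimately show ?thesis using True dim_lincomb4_le_3[OF K] by simp
  next
    case False
    then have "K = 0" if "?f K = 0" for K using rel that by blast
    then have "\<not> cmat.subspace (closure (set_prod V1 V2))"
      unfolding prod by (rule closure_cone_not_subspace)
    with False show ?thesis by blast
  qed
qed

end
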